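(* Let $L$ be a bounded distributive lattice. The Priestley space $P(L^\Diamond)$ is order-homeomorphic to $\mathcal{F}_+^{\Diamond\Box}$, the spectral space $P^+(L^\Diamond)$ is homeomorphic to $\mathcal{F}_+^\Diamond$ and the spectral space $P^-(L^\Diamond)$ is homeomorphic to $\mathcal{F}_+^\Box$.
   Context: For a bounded distributive lattice $D$, its Priestley space is $P(D)=(X_D,\pi_D,\leq)$, where $X_D$ is the set of (proper) prime filters of $D$, $\leq$ is inclusion, and $\pi_D$ is generated by the sets $a^+=\{x\in X_D\mid a\in x\}$ and $a^-=\{x\in X_D\mid a\notin x\}$, $a\in D$. $P^+(D)$ is $X_D$ with the topology $\pi_D^+$ of $\pi_D$-open upsets, and $P^-(D)$ is $X_D$ with the topology $\pi_D^-$ of $\pi_D$-open downsets; both are spectral spaces. $L^\Diamond$ is the bounded distributive lattice freely generated by symbols $\Diamond_a$, $a\in L$, modulo the relations $\Diamond_0=0$ and $\Diamond_{a\vee b}=\Diamond_a\vee\Diamond_b$ for all $a,b\in L$. Write $P(L)=(X,\pi,\leq)$. $\mathcal{F}_+$ is the set of closed sets of $(X,\pi^+)$, i.e. the $\pi$-closed downsets of $X$ (including $\varnothing$), ordered by inclusion. For $U$ open and $K$ compact in $(X,\pi^+)$ let $\Diamond_U=\{C\in\mathcal{F}_+\mid C\cap U\neq\varnothing\}$ and $\Box_K=\{C\in\mathcal{F}_+\mid C\cap K=\varnothing\}$. $\mathcal{F}_+^\Diamond$, $\mathcal{F}_+^\Box$ denote $\mathcal{F}_+$ with the topology generated by all $\Diamond_U$,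 respectively by all $\Box_K$; $\mathcal{F}_+^{\Diamond\Box}$ is $\mathcal{F}_+$ with the join of these topologies and the inclusion order. An order-homeomorphism is a homeomorphism that is an order-isomorphism. *)

theory Defs
  imports "HOL-Analysis.Analysis"
begin

section \<open>The lattice freely generated by the diamonds of a lattice\<close>

text \<open>Bounded distributive lattices are types of sort \<open>{distrib_lattice, bounded_lattice}\<close>;
  this allows the one-element lattice.\<close>

datatype 'a dterm =
    Gen 'a
  | Zero
  | One
  | Meet "'a dterm" "'a dterm"
  | Join "'a dterm" "'a dterm"

text \<open>The least congruence on terms that contains the axioms of bounded distributive lattices
  together with the two defining relations of the diamonds.\<close>

inductive dcong ::
  "'a::{distrib_lattice, bounded_lattice} dterm \<Rightarrow> 'a dterm \<Rightarrow> bool"  (infix \<open>\<approx>\<^sub>d\<close> 50)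
where
  refl: "s \<approx>\<^sub>d s"
| sym: "s \<approx>\<^sub>d t \<Longrightarrow> t \<approx>\<^sub>d s"
| trans: "s \<approx>\<^sub>d t \<Longrightarrow> t \<approx>\<^sub>d u \<Longrightarrow> s \<approx>\<^sub>d u"
| meet_cong: "s \<approx>\<^sub>d s' \<Longrightarrow> t \<approx>\<^sub>d t' \<Longrightarrow> Meet s t \<approx>\<^sub>d Meet s' t'"
| join_cong: "s \<approx>\<^sub>d s' \<Longrightarrow> t \<approx>\<^sub>d t' \<Longrightarrow> Join s t \<approx>\<^sub>d Join s' t'"
| meet_commute: "Meet s t \<approx>\<^sub>d Meet t s"
| join_commute: "Join s t \<approx>\<^sub>d Join t s"
| meet_assoc: "Meet (Meet s t) u \<approx>\<^sub>d Meet s (Meet t u)"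
| join_assoc: "Join (Join s t) u \<approx>\<^sub>d Join s (Join t u)"
| meet_join_absorb: "Meet s (Join s t) \<approx>\<^sub>d s"
| join_meet_absorb: "Join s (Meet s t) \<approx>\<^sub>d s"
| join_meet_distrib: "Join s (Meet t u) \<approx>\<^sub>d Meet (Join s t) (Join s u)"
| join_zero: "Join Zero s \<approx>\<^sub>d s"
| meet_one: "Meet One s \<approx>\<^sub>d s"
| gen_bot: "Gen bot \<approx>\<^sub>d Zero"
| gen_sup: "Gen (sup a b) \<approx>\<^sub>d Join (Gen a) (Gen b)"

quotient_type (overloaded) 'a diamond_lattice =
    "'a::{distrib_lattice, bounded_lattice} dterm" / dcong
  by (intro equivpI reflpI sympI transpI) (blast intro: dcong.refl dcong.sym dcong.trans)+

lift_definition diamond ::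
  "'a::{distrib_lattice, bounded_lattice} \<Rightarrow> 'a diamond_lattice" is Gen .

instantiation diamond_lattice ::
  ("{distrib_lattice, bounded_lattice}") "{distrib_lattice, bounded_lattice}"
begin

lift_definition bot_diamond_lattice :: "'a diamond_lattice" is Zero .

lift_definition top_diamond_lattice :: "'a diamond_lattice" is One .

lift_definition inf_diamond_lattice ::
  "'a diamond_lattice \<Rightarrow> 'a diamond_lattice \<Rightarrow> 'a diamond_lattice" is Meet
  by (rule dcong.meet_cong)

lift_definition sup_diamond_lattice ::
  "'a diamond_lattice \<Rightarrow> 'a diamond_lattice \<Rightarrow> 'a diamond_lattice" is Join
  by (rule dcong.join_cong)

definition less_eq_diamond_lattice :: "'a diamond_lattice \<Rightarrow> 'a diamond_lattice \<Rightarrow> bool"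
  where "less_eq_diamond_lattice x y \<longleftrightarrow> inf x y = x"

definition less_diamond_lattice :: "'a diamond_lattice \<Rightarrow> 'a diamond_lattice \<Rightarrow> bool"
  where "less_diamond_lattice x y \<longleftrightarrow> x \<le> y \<and> x \<noteq> y"

instance
proof
  fix x y z :: "'a diamond_lattice"
  have ic: "inf u v = inf v u" for u v :: "'a diamond_lattice"
    by transfer (rule dcong.meet_commute)
  have sc: "sup u v = sup v u" for u v :: "'a diamond_lattice"
    by transfer (rule dcong.join_commute)
  have ia: "inf (inf u v) w = inf u (inf v w)" for u v w :: "'a diamond_lattice"
    by transfer (rule dcong.meet_assoc)
  have sa: "sup (sup u v) w = sup u (sup v w)" for u v w :: "'a diamond_lattice"
    by transfer (rule dcong.join_assoc)
  have is_abs: "inf u (sup u v) = u" for u v :: "'a diamond_lattice"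
    by transfer (rule dcong.meet_join_absorb)
  have si_abs: "sup u (inf u v) = u" for u v :: "'a diamond_lattice"
    by transfer (rule dcong.join_meet_absorb)
  have sb: "sup bot u = u" for u :: "'a diamond_lattice"
    by transfer (rule dcong.join_zero)
  have it: "inf top u = u" for u :: "'a diamond_lattice"
    by transfer (rule dcong.meet_one)
  have ii: "inf u u = u" for u :: "'a diamond_lattice"
    by (metis is_abs si_abs)
  have le_sup: "u \<le> v \<longleftrightarrow> sup u v = v" for u v :: "'a diamond_lattice"
    unfolding less_eq_diamond_lattice_def by (metis ic sc is_abs si_abs)
  show "x < y \<longleftrightarrow> x \<le> y \<and> \<not> y \<le> x"
    unfolding less_diamond_lattice_def less_eq_diamond_lattice_def by (metis ic ii)
  show "x \<le> x" unfolding less_eq_diamond_lattice_def by (rule ii)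
  show "x \<le> y \<Longrightarrow> y \<le> z \<Longrightarrow> x \<le> z"
    unfolding less_eq_diamond_lattice_def by (metis ia)
  show "x \<le> y \<Longrightarrow> y \<le> x \<Longrightarrow> x = y"
    unfolding less_eq_diamond_lattice_def by (metis ic)
  show "inf x y \<le> x"
    unfolding less_eq_diamond_lattice_def by (metis ia ic ii)
  show "inf x y \<le> y"
    unfolding less_eq_diamond_lattice_def by (metis ia ii)
  show "x \<le> y \<Longrightarrow> x \<le> z \<Longrightarrow> x \<le> inf y z"
    unfolding less_eq_diamond_lattice_def by (metis ia)
  show "x \<le> sup x y"
    unfolding less_eq_diamond_lattice_def by (rule is_abs)
  show "y \<le> sup x y"
    unfolding less_eq_diamond_lattice_def by (metis is_abs sc)
  show "y \<le> x \<Longrightarrow> z \<le> x \<Longrightarrow> sup y z \<le> x"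
    unfolding le_sup by (metis sa)
  show "sup x (inf y z) = inf (sup x y) (sup x z)"
    by transfer (rule dcong.join_meet_distrib)
  show "bot \<le> x" unfolding le_sup by (rule sb)
  show "x \<le> top" unfolding less_eq_diamond_lattice_def by (metis ic it)
qed

end

lemma diamond_bot: "diamond bot = bot"
  by transfer (rule dcong.gen_bot)

lemma diamond_sup: "diamond (sup a b) = sup (diamond a) (diamond b)"
  by transfer (rule dcong.gen_sup)

primrec deval ::
  "('a \<Rightarrow> 'b::{distrib_lattice, bounded_lattice}) \<Rightarrow> 'a dterm \<Rightarrow> 'b" where
  "deval f (Gen a) = f a"
| "deval f Zero = bot"
| "deval f One = top"
| "deval f (Meet s t) = inf (deval f s) (deval f t)"
| "deval f (Join s t) = sup (deval f s) (deval f t)"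

text \<open>Freeness: every join-preserving map preserving the least element extends uniquely to a
  homomorphism of bounded lattices.\<close>

lemma diamond_lattice_universal:
  fixes f :: "'a::{distrib_lattice, bounded_lattice} \<Rightarrow> 'b::{distrib_lattice, bounded_lattice}"
  assumes "f bot = bot" and "\<And>a b. f (sup a b) = sup (f a) (f b)"
  shows "\<exists>!h :: 'a diamond_lattice \<Rightarrow> 'b. h bot = bot \<and> h top = top \<and>
           (\<forall>x y. h (inf x y) = inf (h x) (h y)) \<and> (\<forall>x y. h (sup x y) = sup (h x) (h y)) \<and>
           (\<forall>a. h (diamond a) = f a)"
    (is "\<exists>!h. ?P h")
proof -
  have resp: "s \<approx>\<^sub>d t \<Longrightarrow> deval f s = deval f t" for s t
    by (induction rule: dcong.induct)
      (auto simp: assms inf.commute inf.left_commute sup.commute sup.left_commute sup_inf_distrib1)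
  define h where "h x = deval f (rep_diamond_lattice x)" for x
  have h_abs: "h (abs_diamond_lattice t) = deval f t" for t
    unfolding h_def
    by (rule resp) (rule Quotient3_rep_abs[OF Quotient3_diamond_lattice dcong.refl])
  have P: "?P h"
  proof (intro conjI allI)
    fix x y :: "'a diamond_lattice"
    obtain s t where st: "x = abs_diamond_lattice s" "y = abs_diamond_lattice t"
      by (metis Quotient3_abs_rep[OF Quotient3_diamond_lattice])
    show "h (inf x y) = inf (h x) (h y)" "h (sup x y) = sup (h x) (h y)"
      by (simp_all add: st inf_diamond_lattice.abs_eq sup_diamond_lattice.abs_eq h_abs)
  qed (simp_all add: bot_diamond_lattice.abs_eq top_diamond_lattice.abs_eq
        diamond.abs_eq h_abs)
  have abs_eq: "g (abs_diamond_lattice t) = deval f t" if "?P g" for g t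
  proof (induction t)
    case (Gen a)
    then show ?case using that by (simp add: diamond.abs_eq[symmetric])
  next
    case Zero
    then show ?case using that by (simp add: bot_diamond_lattice.abs_eq[symmetric])
  next
    case One
    then show ?case using that by (simp add: top_diamond_lattice.abs_eq[symmetric])
  next
    case (Meet s t)
    then show ?case using that by (simp add: inf_diamond_lattice.abs_eq[symmetric])
  next
    case (Join s t)
    then show ?case using that by (simp add: sup_diamond_lattice.abs_eq[symmetric])
  qed
  show ?thesis
  proof (rule ex1I[of ?P h])
    show "?P h" by (rule P)
  next
    fix g assume "?P g"
    show "g = h"
    proof
      fix x :: "'a diamond_lattice"
      obtain t where "x = abs_diamond_lattice t"
        by (metis Quotient3_abs_rep[OF Quotient3_diamond_lattice])
      then show "g x = h x" using abs_eq[OF \<open>?P g\<close>] h_abs by simp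
    qed
  qed
qed


section \<open>Topological preliminaries\<close>

text \<open>The topology on \<open>X\<close> with subbasis \<open>\<S>\<close>. Since \<^const>\<open>topology_generated_by\<close> takes the union of
  its generators as the underlying set, \<open>X\<close> is added explicitly; it need not be covered
  by \<open>\<S>\<close> (the empty closed set lies in no \<open>\<Diamond>\<^sub>U\<close>, see below).\<close>

definition generated_topology_on :: "'a set \<Rightarrow> 'a set set \<Rightarrow> 'a topology" where
  "generated_topology_on X \<S> = topology_generated_by (insert X \<S>)"

lemma topspace_generated_topology_on:
  "\<S> \<subseteq> Pow X \<Longrightarrow> topspace (generated_topology_on X \<S>) = X"
  unfolding generated_topology_on_def by (auto simp: topology_generated_by_topspace)

definition join_topology :: "'a topology \<Rightarrow> 'a topology \<Rightarrow> 'a topology" where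
  "join_topology S T = topology_generated_by (Collect (openin S) \<union> Collect (openin T))"

lemma topspace_join_topology:
  "topspace (join_topology S T) = topspace S \<union> topspace T"
  unfolding join_topology_def topology_generated_by_topspace
  by (auto simp: topspace_def)

definition upset_topology :: "'a topology \<Rightarrow> ('a \<Rightarrow> 'a \<Rightarrow> bool) \<Rightarrow> 'a topology" where
  "upset_topology T le =
     topology (\<lambda>U. openin T U \<and> (\<forall>x\<in>U. \<forall>y\<in>topspace T. le x y \<longrightarrow> y \<in> U))"

definition downset_topology :: "'a topology \<Rightarrow> ('a \<Rightarrow> 'a \<Rightarrow> bool) \<Rightarrow> 'a topology" where
  "downset_topology T le =
     topology (\<lambda>U. openin T U \<and> (\<forall>x\<in>U. \<forall>y\<in>topspace T. le y x \<longrightarrow> y \<in> U))"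

lemma openin_upset_topology:
  "openin (upset_topology T le) U \<longleftrightarrow>
     openin T U \<and> (\<forall>x\<in>U. \<forall>y\<in>topspace T. le x y \<longrightarrow> y \<in> U)"
proof -
  have "istopology (\<lambda>U. openin T U \<and> (\<forall>x\<in>U. \<forall>y\<in>topspace T. le x y \<longrightarrow> y \<in> U))"
    unfolding istopology_def by (intro conjI allI impI ballI) (simp_all add: openin_Int openin_Union, blast+)
  then show ?thesis unfolding upset_topology_def by (simp add: topology_inverse')
qed

lemma openin_downset_topology:
  "openin (downset_topology T le) U \<longleftrightarrow>
     openin T U \<and> (\<forall>x\<in>U. \<forall>y\<in>topspace T. le y x \<longrightarrow> y \<in> U)"
proof -
  have "downset_topology T le = upset_topology T (\<lambda>x y. le y x)"
    unfolding downset_topology_def upset_topology_def ..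
  then show ?thesis by (simp add: openin_upset_topology)
qed

definition order_homeomorphic_map ::
  "'a topology \<Rightarrow> ('a \<Rightarrow> 'a \<Rightarrow> bool) \<Rightarrow> 'b topology \<Rightarrow> ('b \<Rightarrow> 'b \<Rightarrow> bool) \<Rightarrow> ('a \<Rightarrow> 'b) \<Rightarrow> bool"
where
  "order_homeomorphic_map S le T le' f \<longleftrightarrow>
     homeomorphic_map S T f \<and>
     (\<forall>x\<in>topspace S. \<forall>y\<in>topspace S. le x y \<longleftrightarrow> le' (f x) (f y))"

definition order_homeomorphic_space ::
  "'a topology \<Rightarrow> ('a \<Rightarrow> 'a \<Rightarrow> bool) \<Rightarrow> 'b topology \<Rightarrow> ('b \<Rightarrow> 'b \<Rightarrow> bool) \<Rightarrow> bool"
where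
  "order_homeomorphic_space S le T le' \<longleftrightarrow> (\<exists>f. order_homeomorphic_map S le T le' f)"


section \<open>The Priestley space and the two spectral spaces of a lattice\<close>

definition prime_filter :: "'a::{distrib_lattice, bounded_lattice} set \<Rightarrow> bool" where
  "prime_filter F \<longleftrightarrow>
     top \<in> F \<and> bot \<notin> F \<and>
     (\<forall>a b. a \<in> F \<longrightarrow> a \<le> b \<longrightarrow> b \<in> F) \<and>
     (\<forall>a b. a \<in> F \<longrightarrow> b \<in> F \<longrightarrow> inf a b \<in> F) \<and>
     (\<forall>a b. sup a b \<in> F \<longrightarrow> a \<in> F \<or> b \<in> F)"

definition plus_set :: "'a::{distrib_lattice, bounded_lattice} \<Rightarrow> 'a set set" where
  "plus_set a = {x. prime_filter x \<and> a \<in> x}"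

definition minus_set :: "'a::{distrib_lattice, bounded_lattice} \<Rightarrow> 'a set set" where
  "minus_set a = {x. prime_filter x \<and> a \<notin> x}"

text \<open>The order of the Priestley space is inclusion of prime filters.\<close>

definition priestley_topology ::
  "'a::{distrib_lattice, bounded_lattice} set topology" where
  "priestley_topology =
     generated_topology_on (Collect prime_filter) (range plus_set \<union> range minus_set)"

lemma topspace_priestley_topology: "topspace priestley_topology = Collect prime_filter"
  unfolding priestley_topology_def
  by (rule topspace_generated_topology_on) (auto simp: plus_set_def minus_set_def)

definition spectral_plus_topology ::
  "'a::{distrib_lattice, bounded_lattice} set topology" where
  "spectral_plus_topology = upset_topology priestley_topology (\<subseteq>)"

definition spectral_minus_topology ::
  "'a::{distrib_lattice, bounded_lattice} set topology" where
  "spectral_minus_topology = downset_topology priestley_topology (\<subseteq>)"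


section \<open>Topologies on the set of closed subsets of a space\<close>

definition closed_sets :: "'a topology \<Rightarrow> 'a set set" where
  "closed_sets T = Collect (closedin T)"

definition hit_set :: "'a topology \<Rightarrow> 'a set \<Rightarrow> 'a set set" where
  "hit_set T U = {C \<in> closed_sets T. C \<inter> U \<noteq> {}}"

definition miss_set :: "'a topology \<Rightarrow> 'a set \<Rightarrow> 'a set set" where
  "miss_set T K = {C \<in> closed_sets T. C \<inter> K = {}}"

definition hit_topology :: "'a topology \<Rightarrow> 'a set topology" where
  "hit_topology T = generated_topology_on (closed_sets T) {hit_set T U |U. openin T U}"

definition miss_topology :: "'a topology \<Rightarrow> 'a set topology" where
  "miss_topology T = generated_topology_on (closed_sets T) {miss_set T K |K. compactin T K}"

definition hit_miss_topology :: "'a topology \<Rightarrow> 'a set topology" where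
  "hit_miss_topology T = join_topology (hit_topology T) (miss_topology T)"

lemma topspace_hit_topology: "topspace (hit_topology T) = closed_sets T"
  unfolding hit_topology_def
  by (rule topspace_generated_topology_on) (auto simp: hit_set_def)

lemma topspace_miss_topology: "topspace (miss_topology T) = closed_sets T"
  unfolding miss_topology_def
  by (rule topspace_generated_topology_on) (auto simp: miss_set_def)

lemma topspace_hit_miss_topology: "topspace (hit_miss_topology T) = closed_sets T"
  by (simp add: hit_miss_topology_def topspace_join_topology topspace_hit_topology
      topspace_miss_topology)

end

theory Submission
  imports Defs
begin

text \<open>A prime filter \<open>F\<close> of \<open>L\<^sup>\<diamond>\<close> is determined by the generators it contains, and these are the
  complement of an ideal \<open>I\<close> of \<open>L\<close>; conversely, by freeness (applied to the two-element lattice)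
  every ideal arises. Ideals of \<open>L\<close> correspond to the open sets of \<open>P\<^sup>+(L)\<close>, so \<open>F\<close> is sent to the
  closed set \<open>{x. x \<inter> I = {}}\<close>. By the prime filter theorem this closed set meets \<open>a\<^sup>+\<close> iff
  \<open>\<diamond>\<^sub>a \<in> F\<close>. Hence the subbasic sets given by \<open>\<diamond>\<^sub>a\<close> correspond to hitting, respectively missing,
  \<open>a\<^sup>+\<close>, and these hit and miss sets generate the respective topologies because the \<open>a\<^sup>+\<close> are a
  basis of compact open sets of \<open>P\<^sup>+(L)\<close>, closed under finite unions.\<close>

section \<open>Separation by prime filters\<close>

text \<open>The last property of \<open>M\<close>, which records maximality, replaces the compactness of the Priestley
  topology in the description of its open upsets and downsets. The lemma avoids the bounds so that
  it can be applied to the dual order.\<close>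

lemma (in distrib_lattice) maximal_filter_avoiding_ideal:
  assumes "F \<noteq> {}" and up: "\<And>a b. a \<in> F \<Longrightarrow> a \<le> b \<Longrightarrow> b \<in> F"
    and inf: "\<And>a b. a \<in> F \<Longrightarrow> b \<in> F \<Longrightarrow> inf a b \<in> F"
    and down: "\<And>a b. a \<in> I \<Longrightarrow> b \<le> a \<Longrightarrow> b \<in> I"
    and sup: "\<And>a b. a \<in> I \<Longrightarrow> b \<in> I \<Longrightarrow> sup a b \<in> I"
    and "F \<inter> I = {}"
  obtains M where "F \<subseteq> M" "M \<inter> I = {}"
    "\<And>a b. a \<in> M \<Longrightarrow> a \<le> b \<Longrightarrow> b \<in> M"
    "\<And>a b. a \<in> M \<Longrightarrow> b \<in> M \<Longrightarrow> inf a b \<in> M"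
    "\<And>a b. sup a b \<in> M \<Longrightarrow> a \<in> M \<or> b \<in> M"
    "\<And>b. b \<notin> M \<Longrightarrow> \<exists>m\<in>M. inf m b \<in> I"
proof -
  define A where "A = {G. F \<subseteq> G \<and> G \<inter> I = {} \<and> (\<forall>a\<in>G. \<forall>b. a \<le> b \<longrightarrow> b \<in> G) \<and>
    (\<forall>a\<in>G. \<forall>b\<in>G. inf a b \<in> G)}"
  have "F \<in> A"
    using assms by (auto simp: A_def)
  have "\<exists>M\<in>A. \<forall>X\<in>A. M \<subseteq> X \<longrightarrow> X = M"
  proof (rule subset_Zorn_nonempty)
    show "A \<noteq> {}"
      using \<open>F \<in> A\<close> by blast
  next
    fix C assume C: "C \<noteq> {}" "subset.chain A C"
    then have sub: "C \<subseteq> A" and chain: "\<And>G H. G \<in> C \<Longrightarrow> H \<in> C \<Longrightarrow> G \<subseteq> H \<or> H \<subseteq> G"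
      by (auto simp: subset.chain_def)
    have "inf a b \<in> \<Union>C" if "a \<in> \<Union>C" "b \<in> \<Union>C" for a b
    proof -
      obtain G H where GH: "G \<in> C" "a \<in> G" "H \<in> C" "b \<in> H"
        using \<open>a \<in> \<Union>C\<close> \<open>b \<in> \<Union>C\<close> by blast
      obtain K where "K \<in> C" "a \<in> K" "b \<in> K"
        using chain[OF GH(1,3)] GH by blast
      then have "inf a b \<in> K"
        using sub unfolding A_def by blast
      with \<open>K \<in> C\<close> show ?thesis
        by blast
    qed
    moreover have "F \<subseteq> \<Union>C" "\<Union>C \<inter> I = {}" "\<forall>a\<in>\<Union>C. \<forall>b. a \<le> b \<longrightarrow> b \<in> \<Union>C"
      using sub C(1) unfolding A_def by blast+
    ultimately show "\<Union>C \<in> A"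
      by (simp add: A_def)
  qed
  then obtain M where "M \<in> A" and max: "\<And>X. X \<in> A \<Longrightarrow> M \<subseteq> X \<Longrightarrow> X = M"
    by blast
  then have M: "F \<subseteq> M" "M \<inter> I = {}" "\<And>a b. a \<in> M \<Longrightarrow> a \<le> b \<Longrightarrow> b \<in> M"
    "\<And>a b. a \<in> M \<Longrightarrow> b \<in> M \<Longrightarrow> inf a b \<in> M"
    unfolding A_def by blast+
  \<comment> \<open>Without a top element, some \<open>m0\<close> in \<open>M\<close> is needed to
    see that the filter \<open>G\<close> below contains \<open>b\<close>, through
    \<open>inf m0 b \<le> b\<close>.\<close>
  obtain m0 where "m0 \<in> M"
    using M(1) \<open>F \<noteq> {}\<close> by blast
  \<comment> \<open>Otherwise the filter \<open>G\<close> generated by \<open>M\<close> and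
    \<open>b\<close> would still miss \<open>I\<close>, against the maximality of
    \<open>M\<close>.\<close>
  have rel: "\<exists>m\<in>M. inf m b \<in> I" if "b \<notin> M" for b
  proof (rule ccontr)
    assume neg: "\<not> ?thesis"
    define G where "G = {c. \<exists>m\<in>M. inf m b \<le> c}"
    have "M \<subseteq> G"
      by (auto simp: G_def intro: le_infI1)
    have "b \<in> G"
      using \<open>m0 \<in> M\<close> by (auto simp: G_def)
    have "G \<inter> I = {}"
      using neg down by (auto simp: G_def)
    have "inf c d \<in> G" if cd: "c \<in> G" "d \<in> G" for c d
    proof -
      obtain m n where mn: "m \<in> M" "inf m b \<le> c" "n \<in> M" "inf n b \<le> d"
        using cd by (auto simp: G_def)
      have "inf (inf m n) b \<le> inf c d"
        by (meson mn inf_mono inf_le1 inf_le2 le_infI order_refl order_trans)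
      then show ?thesis
        using mn M(4) by (auto simp: G_def)
    qed
    moreover have "d \<in> G" if "c \<in> G" "c \<le> d" for c d
      using that by (auto simp: G_def intro: order_trans)
    ultimately have "G \<in> A"
      using M(1) \<open>M \<subseteq> G\<close> \<open>G \<inter> I = {}\<close> by (auto simp: A_def)
    then show False
      using max \<open>M \<subseteq> G\<close> \<open>b \<in> G\<close> that by blast
  qed
  \<comment> \<open>If both \<open>a\<close> and \<open>b\<close> were outside \<open>M\<close>, the
    two witnesses and distributivity would put \<open>inf (inf m n) (sup a b)\<close> into
    \<open>I\<close>, while the filter property puts it into \<open>M\<close>.\<close>
  have "a \<in> M \<or> b \<in> M" if ab: "sup a b \<in> M" for a b
  proof (rule ccontr)
    assume "\<not> ?thesis"
    then obtain m n where mn: "m \<in> M" "inf m a \<in> I" "n \<in> M" "inf n b \<in> I"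
      using rel by blast
    have "inf (inf m n) a \<le> inf m a" "inf (inf m n) b \<le> inf n b"
      by (meson inf_mono inf_le1 inf_le2 order_refl)+
    then have "sup (inf (inf m n) a) (inf (inf m n) b) \<in> I"
      using mn down sup by blast
    then have "inf (inf m n) (sup a b) \<in> I"
      by (simp add: inf_sup_distrib1)
    moreover have "inf (inf m n) (sup a b) \<in> M"
      using mn ab M(4) by blast
    ultimately show False
      using M(2) by blast
  qed
  with M rel that show thesis
    by blast
qed

lemma prime_filter_simps:
  assumes "prime_filter F"
  shows "top \<in> F" "bot \<notin> F" "inf a b \<in> F \<longleftrightarrow> a \<in> F \<and> b \<in> F" "sup a b \<in> F \<longleftrightarrow> a \<in> F \<or> b \<in> F"
  using assms unfolding prime_filter_def by (meson inf_le1 inf_le2 sup_ge1 sup_ge2)+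

lemma prime_filter_up: "prime_filter F \<Longrightarrow> a \<in> F \<Longrightarrow> a \<le> b \<Longrightarrow> b \<in> F"
  unfolding prime_filter_def by blast

lemma plus_set_mono: "a \<le> b \<Longrightarrow> plus_set a \<subseteq> plus_set b"
  and minus_set_antimono: "a \<le> b \<Longrightarrow> minus_set b \<subseteq> minus_set a"
  unfolding plus_set_def minus_set_def using prime_filter_up by blast+

lemma plus_set_bot: "plus_set bot = {}"
  and minus_set_top: "minus_set top = {}"
  and plus_set_sup: "plus_set (sup a b) = plus_set a \<union> plus_set b"
  and minus_set_inf: "minus_set (inf a b) = minus_set a \<union> minus_set b"
  unfolding plus_set_def minus_set_def using prime_filter_simps by blast+

lemma prime_filter_avoiding_ideal:
  fixes F I :: "'a::{distrib_lattice, bounded_lattice} set"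
  assumes "top \<in> F" "bot \<in> I" "F \<inter> I = {}"
    and "\<And>a b. a \<in> F \<Longrightarrow> a \<le> b \<Longrightarrow> b \<in> F"
    and "\<And>a b. a \<in> F \<Longrightarrow> b \<in> F \<Longrightarrow> inf a b \<in> F"
    and "\<And>a b. a \<in> I \<Longrightarrow> b \<le> a \<Longrightarrow> b \<in> I"
    and "\<And>a b. a \<in> I \<Longrightarrow> b \<in> I \<Longrightarrow> sup a b \<in> I"
  obtains M where "prime_filter M" "F \<subseteq> M" "M \<inter> I = {}" "\<And>b. b \<notin> M \<Longrightarrow> \<exists>m\<in>M. inf m b \<in> I"
proof (rule maximal_filter_avoiding_ideal[of F I])
  show "F \<noteq> {}" "F \<inter> I = {}"
    using assms(1,3) by blast+
next
  fix M
  assume M: "F \<subseteq> M" "M \<inter> I = {}" "\<And>a b. a \<in> M \<Longrightarrow> a \<le> b \<Longrightarrow> b \<in> M"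
    "\<And>a b. a \<in> M \<Longrightarrow> b \<in> M \<Longrightarrow> inf a b \<in> M" "\<And>a b. sup a b \<in> M \<Longrightarrow> a \<in> M \<or> b \<in> M"
    "\<And>b. b \<notin> M \<Longrightarrow> \<exists>m\<in>M. inf m b \<in> I"
  have "prime_filter M"
    unfolding prime_filter_def using assms(1,2) M(1-5) by blast
  then show thesis
    using M(1,2,6) by (rule that)
qed (blast intro: assms)+

text \<open>In the opposite lattice \<open>F\<close> and \<open>I\<close> exchange roles. This
  yields an ideal \<open>N\<close> maximal among those containing \<open>I\<close> and missing
  \<open>F\<close>, and its complement is the required prime filter. The last property records
  minimality.\<close>

lemma minimal_prime_filter_avoiding_ideal:
  fixes F I :: "'a::{distrib_lattice, bounded_lattice} set"
  assumes "top \<in> F" "bot \<in> I" "F \<inter> I = {}"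
    and "\<And>a b. a \<in> F \<Longrightarrow> a \<le> b \<Longrightarrow> b \<in> F"
    and "\<And>a b. a \<in> F \<Longrightarrow> b \<in> F \<Longrightarrow> inf a b \<in> F"
    and "\<And>a b. a \<in> I \<Longrightarrow> b \<le> a \<Longrightarrow> b \<in> I"
    and "\<And>a b. a \<in> I \<Longrightarrow> b \<in> I \<Longrightarrow> sup a b \<in> I"
  obtains M where "prime_filter M" "F \<subseteq> M" "M \<inter> I = {}" "\<And>b. b \<in> M \<Longrightarrow> \<exists>m. m \<notin> M \<and> sup m b \<in> F"
proof (rule distrib_lattice.maximal_filter_avoiding_ideal[OF dual_distrib_lattice, of I F])
  show "I \<noteq> {}" "I \<inter> F = {}"
    using assms(2,3) by blast+
next
  fix N
  assume N: "I \<subseteq> N" "N \<inter> F = {}" "\<And>a b. a \<in> N \<Longrightarrow> b \<le> a \<Longrightarrow> b \<in> N"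
    "\<And>a b. a \<in> N \<Longrightarrow> b \<in> N \<Longrightarrow> sup a b \<in> N" "\<And>a b. inf a b \<in> N \<Longrightarrow> a \<in> N \<or> b \<in> N"
    "\<And>b. b \<notin> N \<Longrightarrow> \<exists>m\<in>N. sup m b \<in> F"
  show thesis
  proof (rule that)
    show "prime_filter (- N)"
      unfolding prime_filter_def using assms(1,2) N(1-5) by blast
    show "F \<subseteq> - N" "- N \<inter> I = {}"
      using N(1,2) by blast+
    show "\<exists>m. m \<notin> - N \<and> sup m b \<in> F" if "b \<in> - N" for b
      using N(6)[of b] that by blast
  qed
qed (blast intro: assms)+


section \<open>Open sets of the Priestley space and of the spectral spaces\<close>

lemma openin_priestley_plus_set: "openin priestley_topology (plus_set a)"
  and openin_priestley_minus_set: "openin priestley_topology (minus_set a)"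
  unfolding priestley_topology_def generated_topology_on_def
  by (auto intro: topology_generated_by_Basis)

text \<open>Finite intersections of subbasic sets collapse to a single
  \<open>plus_set a \<inter> minus_set b\<close>, because \<open>plus_set\<close> turns
  \<open>inf\<close> into intersection and \<open>minus_set\<close> turns \<open>sup\<close> into
  intersection.\<close>

lemma openin_priestley_basic_nhd:
  assumes "openin priestley_topology U" "x \<in> U"
  shows "\<exists>a b. a \<in> x \<and> b \<notin> x \<and> plus_set a \<inter> minus_set b \<subseteq> U"
proof -
  have "generate_topology_on
      (insert (Collect prime_filter) (range plus_set \<union> range minus_set)) U"
    using assms(1) unfolding priestley_topology_def generated_topology_on_def
    by (rule openin_topology_generated_by)
  moreover have "prime_filter x"
    using openin_subset[OF assms(1)] assms(2) topspace_priestley_topology by blast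
  ultimately show ?thesis
    using \<open>x \<in> U\<close>
  proof (induction rule: generate_topology_on.induct)
    case (Int U V)
    then obtain a b c d where "a \<in> x" "b \<notin> x" "plus_set a \<inter> minus_set b \<subseteq> U"
      "c \<in> x" "d \<notin> x" "plus_set c \<inter> minus_set d \<subseteq> V"
      by auto
    then have "inf a c \<in> x \<and> sup b d \<notin> x \<and>
        plus_set (inf a c) \<inter> minus_set (sup b d) \<subseteq> U \<inter> V"
      using \<open>prime_filter x\<close> by (auto simp: plus_set_def minus_set_def prime_filter_simps)
    then show ?case
      by blast
  next
    \<comment> \<open>A subbasic set lacks one or both of the two factors; \<open>top\<close> and
      \<open>bot\<close> supply them, as \<open>plus_set top\<close> and
      \<open>minus_set bot\<close> are the whole space.\<close>
    case (Basis U)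
    then show ?case
      using prime_filter_simps(1,2)[of x] by (auto simp: plus_set_def minus_set_def)
  qed blast+
qed

text \<open>For an open upset \<open>U\<close>, the elements \<open>a\<close> with
  \<open>plus_set a \<subseteq> U\<close> form an ideal. If it missed a point \<open>x\<close> of
  \<open>U\<close>, a prime filter \<open>y\<close> above \<open>x\<close>, maximal in avoiding it,
  would lie in \<open>U\<close>; a basic neighbourhood of \<open>y\<close> and maximality then
  produce an element of \<open>y\<close> in the ideal.\<close>

lemma openin_spectral_plus:
  "openin spectral_plus_topology U \<longleftrightarrow>
     U \<subseteq> Collect prime_filter \<and> (\<forall>x\<in>U. \<exists>a\<in>x. plus_set a \<subseteq> U)"
proof
  assume "openin spectral_plus_topology U"
  then have op: "openin priestley_topology U" and sub: "U \<subseteq> Collect prime_filter"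
    and up: "\<And>x y. x \<in> U \<Longrightarrow> prime_filter y \<Longrightarrow> x \<subseteq> y \<Longrightarrow> y \<in> U"
    using openin_subset[of priestley_topology U]
    by (auto simp: spectral_plus_topology_def openin_upset_topology topspace_priestley_topology)
  have "\<exists>a\<in>x. plus_set a \<subseteq> U" if "x \<in> U" for x
  proof (rule ccontr)
    assume neg: "\<not> ?thesis"
    have x: "prime_filter x"
      using that sub by blast
    obtain y where y: "prime_filter y" "x \<subseteq> y" "y \<inter> {a. plus_set a \<subseteq> U} = {}"
      "\<And>b. b \<notin> y \<Longrightarrow> \<exists>m\<in>y. inf m b \<in> {a. plus_set a \<subseteq> U}"
    proof (rule prime_filter_avoiding_ideal[of x "{a. plus_set a \<subseteq> U}"])
      show "x \<inter> {a. plus_set a \<subseteq> U} = {}"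
        using neg by blast
      show "b \<in> {a. plus_set a \<subseteq> U}" if "a \<in> {a. plus_set a \<subseteq> U}" "b \<le> a" for a b
        using that plus_set_mono by blast
      show "b \<in> x" if "a \<in> x" "a \<le> b" for a b
        using x that by (rule prime_filter_up)
    qed (use x in \<open>auto simp: plus_set_bot plus_set_sup prime_filter_simps\<close>)
    then have "y \<in> U"
      using up that by blast
    then obtain a b where ab: "a \<in> y" "b \<notin> y" "plus_set a \<inter> minus_set b \<subseteq> U"
      using openin_priestley_basic_nhd[OF op] by blast
    then obtain m where "m \<in> y" "plus_set (inf m b) \<subseteq> U"
      using y(4) by blast
    \<comment> \<open>A point containing \<open>m\<close> and \<open>a\<close> either contains
      \<open>b\<close>, hence \<open>inf m b\<close>, or lies in the basic neighbourhood. Both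
      places are inside \<open>U\<close>, so \<open>inf m a\<close> belongs to the ideal.\<close>
    moreover have "plus_set (inf m a) \<subseteq> plus_set (inf m b) \<union> plus_set a \<inter> minus_set b"
      by (auto simp: plus_set_def minus_set_def prime_filter_simps)
    ultimately have "plus_set (inf m a) \<subseteq> U" "inf m a \<in> y"
      using ab(1,3) prime_filter_simps(3)[OF y(1)] by blast+
    then show False
      using y(3) by blast
  qed
  with sub show "U \<subseteq> Collect prime_filter \<and> (\<forall>x\<in>U. \<exists>a\<in>x. plus_set a \<subseteq> U)"
    by blast
next
  assume U: "U \<subseteq> Collect prime_filter \<and> (\<forall>x\<in>U. \<exists>a\<in>x. plus_set a \<subseteq> U)"
  then have "\<exists>T. openin priestley_topology T \<and> x \<in> T \<and> T \<subseteq> U" if "x \<in> U" for x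
    using that openin_priestley_plus_set unfolding plus_set_def by blast
  then have "openin priestley_topology U"
    using openin_subopen by blast
  moreover have "y \<in> U" if "x \<in> U" "prime_filter y" "x \<subseteq> y" for x y
    using U that unfolding plus_set_def by blast
  ultimately show "openin spectral_plus_topology U"
    by (simp add: spectral_plus_topology_def openin_upset_topology topspace_priestley_topology)
qed

text \<open>Dual argument: the elements \<open>a\<close> with
  \<open>minus_set a \<subseteq> U\<close> form a filter, which lies inside \<open>x\<close> if the
  claim fails at \<open>x\<close>. A minimal prime filter \<open>y\<close> between this filter and
  \<open>x\<close> is in \<open>U\<close>, since \<open>U\<close> is a downset.\<close>

lemma openin_spectral_minus:
  "openin spectral_minus_topology U \<longleftrightarrow>
     U \<subseteq> Collect prime_filter \<and> (\<forall>x\<in>U. \<exists>a. a \<notin> x \<and> minus_set a \<subseteq> U)"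
proof
  assume "openin spectral_minus_topology U"
  then have op: "openin priestley_topology U" and sub: "U \<subseteq> Collect prime_filter"
    and down: "\<And>x y. x \<in> U \<Longrightarrow> prime_filter y \<Longrightarrow> y \<subseteq> x \<Longrightarrow> y \<in> U"
    using openin_subset[of priestley_topology U]
    by (auto simp: spectral_minus_topology_def openin_downset_topology topspace_priestley_topology)
  have "\<exists>a. a \<notin> x \<and> minus_set a \<subseteq> U" if "x \<in> U" for x
  proof (rule ccontr)
    assume neg: "\<not> ?thesis"
    have x: "prime_filter x"
      using that sub by blast
    obtain y where y: "prime_filter y" "{a. minus_set a \<subseteq> U} \<subseteq> y" "y \<inter> - x = {}"
      "\<And>b. b \<in> y \<Longrightarrow> \<exists>m. m \<notin> y \<and> sup m b \<in> {a. minus_set a \<subseteq> U}"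
    proof (rule minimal_prime_filter_avoiding_ideal[of "{a. minus_set a \<subseteq> U}" "- x"])
      show "{a. minus_set a \<subseteq> U} \<inter> - x = {}"
        using neg by blast
      show "b \<in> {a. minus_set a \<subseteq> U}" if "a \<in> {a. minus_set a \<subseteq> U}" "a \<le> b" for a b
        using that minus_set_antimono by blast
      show "b \<in> - x" if "a \<in> - x" "b \<le> a" for a b
        using that prime_filter_up[OF x] by blast
    qed (use x in \<open>auto simp: minus_set_top minus_set_inf prime_filter_simps\<close>)
    then have "y \<in> U"
      using down that by blast
    then obtain a b where ab: "a \<in> y" "b \<notin> y" "plus_set a \<inter> minus_set b \<subseteq> U"
      using openin_priestley_basic_nhd[OF op] by blast
    then obtain m where "m \<notin> y" "minus_set (sup m a) \<subseteq> U"
      using y(4) by blast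
    \<comment> \<open>A point containing neither \<open>m\<close> nor \<open>b\<close> either
      contains \<open>a\<close>, and is in the basic neighbourhood, or omits \<open>sup m a\<close>.
      So \<open>sup m b\<close> lies in the filter but not in \<open>y\<close>.\<close>
    moreover have "minus_set (sup m b) \<subseteq> minus_set (sup m a) \<union> plus_set a \<inter> minus_set b"
      by (auto simp: plus_set_def minus_set_def prime_filter_simps)
    ultimately have "minus_set (sup m b) \<subseteq> U" "sup m b \<notin> y"
      using ab(2,3) prime_filter_simps(4)[OF y(1)] by blast+
    then show False
      using y(2) by blast
  qed
  with sub show "U \<subseteq> Collect prime_filter \<and> (\<forall>x\<in>U. \<exists>a. a \<notin> x \<and> minus_set a \<subseteq> U)"
    by blast
next
  assume U: "U \<subseteq> Collect prime_filter \<and> (\<forall>x\<in>U. \<exists>a. a \<notin> x \<and> minus_set a \<subseteq> U)"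
  then have "\<exists>T. openin priestley_topology T \<and> x \<in> T \<and> T \<subseteq> U" if "x \<in> U" for x
    using that openin_priestley_minus_set unfolding minus_set_def by blast
  then have "openin priestley_topology U"
    using openin_subopen by blast
  moreover have "y \<in> U" if "x \<in> U" "prime_filter y" "y \<subseteq> x" for x y
    using U that unfolding minus_set_def by blast
  ultimately show "openin spectral_minus_topology U"
    by (simp add: spectral_minus_topology_def openin_downset_topology topspace_priestley_topology)
qed

lemma topspace_spectral_plus: "topspace spectral_plus_topology = Collect prime_filter"
proof
  show "topspace spectral_plus_topology \<subseteq> Collect prime_filter"
    using openin_topspace openin_spectral_plus by metis
  have "openin spectral_plus_topology (Collect prime_filter)"
    unfolding openin_spectral_plus using prime_filter_simps(1) by (auto simp: plus_set_def)
  then show "Collect prime_filter \<subseteq> topspace spectral_plus_topology"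
    by (rule openin_subset)
qed

lemma topspace_spectral_minus: "topspace spectral_minus_topology = Collect prime_filter"
proof
  show "topspace spectral_minus_topology \<subseteq> Collect prime_filter"
    using openin_topspace openin_spectral_minus by metis
  have "openin spectral_minus_topology (Collect prime_filter)"
    unfolding openin_spectral_minus using prime_filter_simps(2) by (auto simp: minus_set_def)
  then show "Collect prime_filter \<subseteq> topspace spectral_minus_topology"
    by (rule openin_subset)
qed

lemma openin_spectral_plus_plus_set: "openin spectral_plus_topology (plus_set a)"
  unfolding openin_spectral_plus by (auto simp: plus_set_def)

lemma openin_spectral_minus_minus_set: "openin spectral_minus_topology (minus_set a)"
  unfolding openin_spectral_minus by (auto simp: minus_set_def)

section \<open>Compactness of the basic open sets\<close>

lemma prime_filter_containing:
  fixes I :: "'a::{distrib_lattice, bounded_lattice} set"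
  assumes "bot \<in> I" "\<And>a b. a \<in> I \<Longrightarrow> b \<le> a \<Longrightarrow> b \<in> I"
    and "\<And>a b. a \<in> I \<Longrightarrow> b \<in> I \<Longrightarrow> sup a b \<in> I" and "a \<notin> I"
  obtains x where "prime_filter x" "a \<in> x" "x \<inter> I = {}"
proof (rule prime_filter_avoiding_ideal[of "{a..}" I])
  show "{a..} \<inter> I = {}"
    using assms(2,4) by auto
qed (use assms in \<open>auto intro: order_trans\<close>)

text \<open>The elements \<open>b\<close> for which \<open>plus_set b\<close> has a finite subcover
  form an ideal. If \<open>a\<close> were outside, a prime filter containing \<open>a\<close> and
  missing the ideal would lie in some member \<open>U\<close> of the cover, hence in some
  \<open>plus_set b \<subseteq> U\<close>; then \<open>{U}\<close> alone covers
  \<open>plus_set b\<close>, a contradiction.\<close>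

lemma compactin_spectral_plus_plus_set: "compactin spectral_plus_topology (plus_set a)"
  unfolding compactin_def
proof (intro conjI allI impI)
  show "plus_set a \<subseteq> topspace spectral_plus_topology"
    by (auto simp: topspace_spectral_plus plus_set_def)
  fix \<U> :: "'a set set set"
  assume cov: "(\<forall>U\<in>\<U>. openin spectral_plus_topology U) \<and> plus_set a \<subseteq> \<Union>\<U>"
  define I where "I = {b. \<exists>\<F>. finite \<F> \<and> \<F> \<subseteq> \<U> \<and> plus_set b \<subseteq> \<Union>\<F>}"
  have "a \<in> I"
  proof (rule ccontr)
    assume "a \<notin> I"
    obtain x where x: "prime_filter x" "a \<in> x" "x \<inter> I = {}"
    proof (rule prime_filter_containing[of I a])
      show "bot \<in> I"
        by (auto simp: I_def plus_set_bot)
      show "c \<in> I" if "b \<in> I" "c \<le> b" for b c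
      proof -
        have "plus_set c \<subseteq> plus_set b"
          using that(2) by (rule plus_set_mono)
        with \<open>b \<in> I\<close> show ?thesis
          unfolding I_def by (blast intro: order_trans)
      qed
      show "sup b c \<in> I" if bc: "b \<in> I" "c \<in> I" for b c
      proof -
        obtain \<F> \<G> where "finite \<F>" "\<F> \<subseteq> \<U>" "plus_set b \<subseteq> \<Union>\<F>"
          "finite \<G>" "\<G> \<subseteq> \<U>" "plus_set c \<subseteq> \<Union>\<G>"
          using bc by (auto simp: I_def)
        then have "finite (\<F> \<union> \<G>) \<and> \<F> \<union> \<G> \<subseteq> \<U> \<and> plus_set (sup b c) \<subseteq> \<Union>(\<F> \<union> \<G>)"
          by (auto simp: plus_set_sup)
        then show ?thesis
          unfolding I_def by (intro CollectI exI)
      qed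
    qed (rule \<open>a \<notin> I\<close>)
    then obtain U where "U \<in> \<U>" "x \<in> U"
      using cov by (auto simp: plus_set_def)
    then obtain b where "b \<in> x" "plus_set b \<subseteq> U"
      using cov openin_spectral_plus[of U] by blast
    then have "b \<in> I"
      using \<open>U \<in> \<U>\<close> by (auto simp: I_def intro!: exI[of _ "{U}"])
    with \<open>b \<in> x\<close> show False
      using x(3) by blast
  qed
  then show "\<exists>\<F>. finite \<F> \<and> \<F> \<subseteq> \<U> \<and> plus_set a \<subseteq> \<Union>\<F>"
    by (simp add: I_def)
qed


section \<open>Hit and miss topologies over the spectral space\<close>

lemma closedin_spectral_plus:
  fixes C :: "'a::{distrib_lattice, bounded_lattice} set set"
  shows "closedin spectral_plus_topology C \<longleftrightarrow> C \<subseteq> Collect prime_filter \<and>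
     (\<forall>x. prime_filter x \<longrightarrow> (\<forall>a\<in>x. plus_set a \<inter> C \<noteq> {}) \<longrightarrow> x \<in> C)"
proof -
  have "plus_set a \<subseteq> Collect prime_filter - C \<longleftrightarrow> plus_set a \<inter> C = {}" for a :: 'a
    by (auto simp: plus_set_def)
  then show ?thesis
    unfolding closedin_def openin_spectral_plus topspace_spectral_plus by auto
qed

lemma openin_spectral_plus_eq_Union:
  assumes "openin spectral_plus_topology U"
  shows "U = \<Union>{plus_set a |a. plus_set a \<subseteq> U}"
proof
  show "U \<subseteq> \<Union>{plus_set a |a. plus_set a \<subseteq> U}"
  proof
    fix x assume "x \<in> U"
    then obtain a where a: "a \<in> x" "plus_set a \<subseteq> U" "prime_filter x"
      using assms openin_spectral_plus by blast
    then have "x \<in> plus_set a"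
      by (simp add: plus_set_def)
    with a(2) show "x \<in> \<Union>{plus_set a |a. plus_set a \<subseteq> U}"
      by blast
  qed
qed blast

lemma openin_spectral_minus_eq_Union:
  assumes "openin spectral_minus_topology U"
  shows "U = \<Union>{minus_set a |a. minus_set a \<subseteq> U}"
proof
  show "U \<subseteq> \<Union>{minus_set a |a. minus_set a \<subseteq> U}"
  proof
    fix x assume "x \<in> U"
    then obtain a where a: "a \<notin> x" "minus_set a \<subseteq> U" "prime_filter x"
      using assms openin_spectral_minus by blast
    then have "x \<in> minus_set a"
      by (simp add: minus_set_def)
    with a(2) show "x \<in> \<Union>{minus_set a |a. minus_set a \<subseteq> U}"
      by blast
  qed
qed blast

lemma hit_set_Union: "hit_set T (\<Union>\<V>) = \<Union>(hit_set T ` \<V>)"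
  by (auto simp: hit_set_def)

text \<open>Hitting commutes with unions, so hit sets of basic open sets suffice as
  generators.\<close>

lemma hit_set_eq_Union:
  assumes "openin spectral_plus_topology U"
  shows "hit_set spectral_plus_topology U =
    \<Union>(hit_set spectral_plus_topology ` {plus_set a |a. plus_set a \<subseteq> U})"
  using hit_set_Union openin_spectral_plus_eq_Union[OF assms] by metis

text \<open>A finite subcover of \<open>K\<close> by basic sets inside \<open>U\<close> collapses to
  one basic set, since \<open>plus_set\<close> turns \<open>sup\<close> into union and
  \<open>bot\<close> into the empty set.\<close>

lemma compactin_subset_plus_set:
  assumes "compactin spectral_plus_topology K" "openin spectral_plus_topology U" "K \<subseteq> U"
  obtains a where "K \<subseteq> plus_set a" "plus_set a \<subseteq> U"
proof -
  define \<U> where "\<U> = {plus_set a |a. plus_set a \<subseteq> U}"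
  have "\<forall>V\<in>\<U>. openin spectral_plus_topology V"
    by (auto simp: \<U>_def openin_spectral_plus_plus_set)
  moreover have "K \<subseteq> \<Union>\<U>"
    using assms(3) openin_spectral_plus_eq_Union[OF assms(2)] unfolding \<U>_def by blast
  ultimately obtain \<F> where \<F>: "finite \<F>" "\<F> \<subseteq> \<U>" "K \<subseteq> \<Union>\<F>"
    using compactinD[OF assms(1)] by metis
  from \<F>(1,2) have "\<exists>a. \<Union>\<F> = plus_set a"
  proof (induction rule: finite_induct)
    case empty
    have "\<Union>{} = plus_set bot"
      by (simp add: plus_set_bot)
    then show ?case
      by blast
  next
    case (insert V \<F>)
    then obtain b where "\<Union>\<F> = plus_set b"
      by blast
    moreover obtain a where "V = plus_set a"
      using insert.prems by (auto simp: \<U>_def)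
    ultimately have "\<Union>(insert V \<F>) = plus_set (sup a b)"
      by (simp add: plus_set_sup)
    then show ?case
      by (rule exI)
  qed
  then obtain a where a: "\<Union>\<F> = plus_set a"
    by (rule exE)
  moreover have "\<Union>\<F> \<subseteq> U"
    using \<F>(2) by (auto simp: \<U>_def)
  ultimately show thesis
    using \<F>(3) that by simp
qed

text \<open>If a closed \<open>C\<close> misses the compact \<open>K\<close>, its complement is an
  open neighbourhood of \<open>K\<close>, and some \<open>plus_set a\<close> fits in between. Hence
  missing basic open sets suffices for the generators.\<close>

lemma miss_set_eq_Union:
  assumes "compactin spectral_plus_topology K"
  shows "miss_set spectral_plus_topology K =
    \<Union>{miss_set spectral_plus_topology (plus_set a) |a. K \<subseteq> plus_set a}"
proof
  show "miss_set spectral_plus_topology K \<subseteq>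
    \<Union>{miss_set spectral_plus_topology (plus_set a) |a. K \<subseteq> plus_set a}"
  proof
    fix C assume C: "C \<in> miss_set spectral_plus_topology K"
    then have "openin spectral_plus_topology (topspace spectral_plus_topology - C)"
      by (auto simp: miss_set_def closed_sets_def)
    moreover have "K \<subseteq> topspace spectral_plus_topology - C"
      using C compactin_subset_topspace[OF assms] by (auto simp: miss_set_def)
    ultimately obtain a where a: "K \<subseteq> plus_set a"
      "plus_set a \<subseteq> topspace spectral_plus_topology - C"
      by (rule compactin_subset_plus_set[OF assms])
    then have "C \<in> miss_set spectral_plus_topology (plus_set a)"
      using C by (auto simp: miss_set_def)
    with a(1) show "C \<in> \<Union>{miss_set spectral_plus_topology (plus_set a) |a. K \<subseteq> plus_set a}"
      by blast
  qed
qed (auto simp: miss_set_def)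


section \<open>The closed set of a prime filter of the diamond lattice\<close>

text \<open>Elements are classes of terms, so structural induction on terms descends to the
  quotient: the diamonds generate.\<close>

lemma diamond_lattice_induct:
  assumes "\<And>a. P (diamond a)" "P bot" "P top"
    "\<And>s t. P s \<Longrightarrow> P t \<Longrightarrow> P (inf s t)" "\<And>s t. P s \<Longrightarrow> P t \<Longrightarrow> P (sup s t)"
  shows "P t"
proof -
  obtain u where "t = abs_diamond_lattice u"
    by (metis Quotient3_abs_rep[OF Quotient3_diamond_lattice])
  moreover have "P (abs_diamond_lattice u)"
  proof (induction u)
    case (Gen a)
    show ?case using assms(1)[of a] by (simp add: diamond.abs_eq)
  next
    case Zero
    show ?case using assms(2) by (simp add: bot_diamond_lattice.abs_eq)
  next
    case One
    show ?case using assms(3) by (simp add: top_diamond_lattice.abs_eq)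
  next
    case (Meet u v)
    show ?case using assms(4)[OF Meet] by (simp add: inf_diamond_lattice.abs_eq)
  next
    case (Join u v)
    show ?case using assms(5)[OF Join] by (simp add: sup_diamond_lattice.abs_eq)
  qed
  ultimately show ?thesis
    by simp
qed

text \<open>Prime filters turn \<open>inf\<close> and \<open>sup\<close> into conjunction and
  disjunction of memberships, so the implication from \<open>F\<close> to \<open>G\<close> passes
  from the generators to all elements.\<close>

lemma prime_filter_diamond_le:
  assumes "prime_filter F" "prime_filter G" "\<And>a. diamond a \<in> F \<Longrightarrow> diamond a \<in> G"
  shows "F \<subseteq> G"
proof
  fix t assume "t \<in> F"
  moreover have "t \<in> F \<longrightarrow> t \<in> G"
    by (induction t rule: diamond_lattice_induct) (use assms in \<open>auto simp: prime_filter_simps\<close>)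
  ultimately show "t \<in> G"
    by blast
qed

lemma prime_filter_of_diamonds:
  fixes P :: "'a::{distrib_lattice, bounded_lattice} \<Rightarrow> bool"
  assumes "\<not> P bot" "\<And>a b. P (sup a b) \<longleftrightarrow> P a \<or> P b"
  obtains F where "prime_filter F" "\<And>a. diamond a \<in> F \<longleftrightarrow> P a"
proof -
  \<comment> \<open>\<open>bool\<close> serves as the two-element lattice, with \<open>False\<close>
    as \<open>bot\<close> and disjunction as \<open>sup\<close>; the assumptions on \<open>P\<close>
    become those of freeness.\<close>
  have "P bot = bot" "\<And>a b. P (sup a b) = sup (P a) (P b)"
    using assms by simp_all
  from diamond_lattice_universal[OF this] obtain h where
    h: "h bot = bot" "h top = top" "\<And>x y. h (inf x y) = inf (h x) (h y)"
       "\<And>x y. h (sup x y) = sup (h x) (h y)" "\<And>a. h (diamond a) = P a"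
    by blast
  have "h b" if "h a" "a \<le> b" for a b
    using h(3)[of a b] that by (simp add: inf_absorb1)
  then have "prime_filter (Collect h)"
    unfolding prime_filter_def using h(1-4) by auto
  with h(5) that show thesis
    by force
qed

text \<open>For prime \<open>F\<close>, these are the points disjoint from the ideal of all
  \<open>a\<close> with \<open>diamond a \<notin> F\<close>, that is, the complement of the union of
  \<open>plus_set a\<close> over that ideal.\<close>

definition diamond_closed_set ::
  "'a::{distrib_lattice, bounded_lattice} diamond_lattice set \<Rightarrow> 'a set set" where
  "diamond_closed_set F = {x. prime_filter x \<and> (\<forall>a\<in>x. diamond a \<in> F)}"

lemma diamond_closed_set_hits_plus_set:
  assumes "prime_filter F"
  shows "diamond_closed_set F \<inter> plus_set a \<noteq> {} \<longleftrightarrow> diamond a \<in> F"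
proof
  show "diamond a \<in> F" if "diamond_closed_set F \<inter> plus_set a \<noteq> {}"
    using that by (auto simp: diamond_closed_set_def plus_set_def)
  assume "diamond a \<in> F"
  obtain x where "prime_filter x" "a \<in> x" "x \<inter> {b. diamond b \<notin> F} = {}"
  proof (rule prime_filter_containing[of "{b. diamond b \<notin> F}" a])
    show "c \<in> {b. diamond b \<notin> F}" if "b \<in> {b. diamond b \<notin> F}" "c \<le> b" for b c
    proof -
      \<comment> \<open>Preserving joins makes \<open>diamond\<close> monotone, so the generators
        outside \<open>F\<close> come from a downward closed set.\<close>
      have "diamond b = sup (diamond c) (diamond b)"
        using that(2) by (simp add: diamond_sup[symmetric] sup_absorb2)
      then show ?thesis
        using that(1) assms prime_filter_simps(4) by (metis mem_Collect_eq)
    qed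
  qed (use assms \<open>diamond a \<in> F\<close> in \<open>auto simp: diamond_bot diamond_sup prime_filter_simps\<close>)
  then show "diamond_closed_set F \<inter> plus_set a \<noteq> {}"
    by (auto simp: diamond_closed_set_def plus_set_def)
qed

text \<open>If every basic neighbourhood of \<open>x\<close> hits the set, then
  \<open>diamond a \<in> F\<close> for each \<open>a \<in> x\<close>, which is the condition for
  \<open>x\<close> to belong to it.\<close>

lemma diamond_closed_set_closed:
  assumes "prime_filter F"
  shows "diamond_closed_set F \<in> closed_sets spectral_plus_topology"
proof -
  have "x \<in> diamond_closed_set F"
    if "prime_filter x" "\<forall>a\<in>x. plus_set a \<inter> diamond_closed_set F \<noteq> {}" for x
    using that diamond_closed_set_hits_plus_set[OF assms]
    by (simp add: diamond_closed_set_def Int_commute)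
  then show ?thesis
    unfolding closed_sets_def closedin_spectral_plus mem_Collect_eq
    by (auto simp: diamond_closed_set_def)
qed

lemma diamond_closed_set_subset_iff:
  assumes "prime_filter F" "prime_filter G"
  shows "diamond_closed_set F \<subseteq> diamond_closed_set G \<longleftrightarrow> F \<subseteq> G"
proof
  show "diamond_closed_set F \<subseteq> diamond_closed_set G" if "F \<subseteq> G"
    using that by (auto simp: diamond_closed_set_def)
  assume "diamond_closed_set F \<subseteq> diamond_closed_set G"
  \<comment> \<open>The larger closed set hits every \<open>plus_set a\<close> that the smaller one
    hits, so \<open>G\<close> contains the diamonds in \<open>F\<close>, and these decide
    inclusion.\<close>
  then show "F \<subseteq> G"
    using assms by (intro prime_filter_diamond_le)
      (auto simp flip: diamond_closed_set_hits_plus_set)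
qed

lemma bij_betw_diamond_closed_set:
  "bij_betw diamond_closed_set (Collect prime_filter)
     (closed_sets (spectral_plus_topology :: 'a::{distrib_lattice, bounded_lattice} set topology))"
  unfolding bij_betw_def
proof
  show "inj_on diamond_closed_set (Collect prime_filter)"
    by (auto simp: inj_on_def set_eq_subset diamond_closed_set_subset_iff)
  have "C \<in> diamond_closed_set ` Collect prime_filter"
    if "C \<in> closed_sets spectral_plus_topology" for C :: "'a set set"
  proof -
    have C: "closedin spectral_plus_topology C"
      using that by (simp add: closed_sets_def)
    \<comment> \<open>Hitting \<open>C\<close> fails for \<open>bot\<close> and distributes over
      \<open>sup\<close>, so it prescribes the generators of a prime filter.\<close>
    obtain F where F: "prime_filter F" "\<And>a. diamond a \<in> F \<longleftrightarrow> plus_set a \<inter> C \<noteq> {}"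
    proof (rule prime_filter_of_diamonds[of "\<lambda>a. plus_set a \<inter> C \<noteq> {}"])
    qed (auto simp: plus_set_bot plus_set_sup)
    \<comment> \<open>Membership in the left side says that every basic neighbourhood of the point
      hits \<open>C\<close>; as \<open>C\<close> is closed, this is membership in
      \<open>C\<close>.\<close>
    have "diamond_closed_set F = C"
      using C unfolding closedin_spectral_plus diamond_closed_set_def F(2) plus_set_def by blast
    with F(1) show ?thesis
      by blast
  qed
  then show "diamond_closed_set ` Collect prime_filter =
      closed_sets (spectral_plus_topology :: 'a set topology)"
    using diamond_closed_set_closed by blast
qed


section \<open>The homeomorphisms\<close>

lemma diamond_closed_set_vimage_hit_set:
  "diamond_closed_set -` hit_set spectral_plus_topology (plus_set a) \<inter> Collect prime_filter =
     plus_set (diamond a)"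
  using diamond_closed_set_hits_plus_set
  by (auto simp: hit_set_def diamond_closed_set_closed plus_set_def[of "diamond a"])

lemma diamond_closed_set_vimage_miss_set:
  "diamond_closed_set -` miss_set spectral_plus_topology (plus_set a) \<inter> Collect prime_filter =
     minus_set (diamond a)"
  using diamond_closed_set_hits_plus_set
  by (auto simp: miss_set_def diamond_closed_set_closed minus_set_def[of "diamond a"])

lemma openin_vimage_Union:
  assumes "\<And>V. V \<in> \<V> \<Longrightarrow> openin X (f -` V \<inter> S)"
  shows "openin X (f -` \<Union>\<V> \<inter> S)"
proof -
  have "f -` \<Union>\<V> \<inter> S = \<Union>((\<lambda>V. f -` V \<inter> S) ` \<V>)"
    by blast
  moreover have "openin X (\<Union>((\<lambda>V. f -` V \<inter> S) ` \<V>))"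
    using assms by (intro openin_Union) blast
  ultimately show ?thesis
    by (simp only:)
qed

lemma diamond_closed_set_image:
  "diamond_closed_set ` Collect prime_filter = closed_sets spectral_plus_topology"
  using bij_betw_diamond_closed_set by (rule bij_betw_imp_surj_on)

text \<open>\<open>X\<close> is kept abstract to cover both the Priestley topology and
  \<open>spectral_plus_topology\<close>. Preimages of hit sets are unions of sets
  \<open>plus_set (diamond a)\<close>.\<close>

lemma continuous_map_into_hit_topology:
  assumes "topspace X = Collect prime_filter" "\<And>t. openin X (plus_set t)"
  shows "continuous_map X (hit_topology spectral_plus_topology) diamond_closed_set"
  unfolding hit_topology_def generated_topology_on_def
proof (rule continuous_on_generated_topo)
  fix V :: "'a set set set"
  assume "V \<in> insert (closed_sets spectral_plus_topology)
    {hit_set spectral_plus_topology U |U. openin spectral_plus_topology U}"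
  then consider "V = closed_sets spectral_plus_topology"
    | U where "openin spectral_plus_topology U" "V = hit_set spectral_plus_topology U"
    by blast
  then show "openin X (diamond_closed_set -` V \<inter> topspace X)"
  proof cases
    case 1
    then have "diamond_closed_set -` V \<inter> topspace X = topspace X"
      using assms(1) diamond_closed_set_closed by blast
    then show ?thesis
      by simp
  next
    case (2 U)
    show ?thesis
      unfolding 2(2) hit_set_eq_Union[OF 2(1)] assms(1)
      by (rule openin_vimage_Union) (auto simp: diamond_closed_set_vimage_hit_set assms(2))
  qed
qed (use assms(1) diamond_closed_set_closed in blast)

text \<open>Here \<open>X\<close> stands for the Priestley topology or
  \<open>spectral_minus_topology\<close>; preimages of miss sets are unions of sets
  \<open>minus_set (diamond a)\<close>.\<close>

lemma continuous_map_into_miss_topology: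
  assumes "topspace X = Collect prime_filter" "\<And>t. openin X (minus_set t)"
  shows "continuous_map X (miss_topology spectral_plus_topology) diamond_closed_set"
  unfolding miss_topology_def generated_topology_on_def
proof (rule continuous_on_generated_topo)
  fix V :: "'a set set set"
  assume "V \<in> insert (closed_sets spectral_plus_topology)
    {miss_set spectral_plus_topology K |K. compactin spectral_plus_topology K}"
  then consider "V = closed_sets spectral_plus_topology"
    | K where "compactin spectral_plus_topology K" "V = miss_set spectral_plus_topology K"
    by blast
  then show "openin X (diamond_closed_set -` V \<inter> topspace X)"
  proof cases
    case 1
    then have "diamond_closed_set -` V \<inter> topspace X = topspace X"
      using assms(1) diamond_closed_set_closed by blast
    then show ?thesis
      by simp
  next
    case (2 K)
    show ?thesis
      unfolding 2(2) miss_set_eq_Union[OF 2(1)] assms(1)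
      by (rule openin_vimage_Union) (auto simp: diamond_closed_set_vimage_miss_set assms(2))
  qed
qed (use assms(1) diamond_closed_set_closed in blast)

lemma continuous_map_into_join_topology:
  assumes "continuous_map X S f" "continuous_map X T f"
  shows "continuous_map X (join_topology S T) f"
  unfolding join_topology_def
proof (rule continuous_on_generated_topo)
  show "openin X (f -` U \<inter> topspace X)" if "U \<in> Collect (openin S) \<union> Collect (openin T)" for U
    using that assms by (auto simp: continuous_map_alt)
  have "f ` topspace X \<subseteq> topspace S"
    using assms(1) by (auto simp: continuous_map_def)
  then show "f ` topspace X \<subseteq> \<Union>(Collect (openin S) \<union> Collect (openin T))"
    using openin_topspace[of S] by blast
qed

lemma openin_join_topology:
  assumes "openin S U \<or> openin T U"
  shows "openin (join_topology S T) U"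
  using assms unfolding join_topology_def by (auto intro: topology_generated_by_Basis)

section \<open>Continuity of the inverse map\<close>

definition closed_set_filter ::
  "'a::{distrib_lattice, bounded_lattice} set set \<Rightarrow> 'a diamond_lattice set" where
  "closed_set_filter = inv_into (Collect prime_filter) diamond_closed_set"

lemma closed_set_filter:
  assumes "C \<in> closed_sets spectral_plus_topology"
  shows "prime_filter (closed_set_filter C)" "diamond_closed_set (closed_set_filter C) = C"
proof -
  have C: "C \<in> diamond_closed_set ` Collect prime_filter"
    using assms diamond_closed_set_image by blast
  show "prime_filter (closed_set_filter C)"
    using inv_into_into[OF C] by (simp add: closed_set_filter_def)
  show "diamond_closed_set (closed_set_filter C) = C"
    using f_inv_into_f[OF C] by (simp add: closed_set_filter_def)
qed

lemma closed_set_filter_diamond_closed_set: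
  "prime_filter F \<Longrightarrow> closed_set_filter (diamond_closed_set F) = F"
  unfolding closed_set_filter_def
  by (rule bij_betw_inv_into_left[OF bij_betw_diamond_closed_set]) simp

lemma diamond_mem_closed_set_filter:
  assumes "C \<in> closed_sets spectral_plus_topology"
  shows "diamond a \<in> closed_set_filter C \<longleftrightarrow> C \<inter> plus_set a \<noteq> {}"
  using diamond_closed_set_hits_plus_set[OF closed_set_filter(1)[OF assms], of a]
  by (simp add: closed_set_filter(2)[OF assms])

text \<open>This is the preimage of \<open>plus_set t\<close> under the inverse map. Induction on
  \<open>t\<close> starts from hit sets of basic open sets; \<open>inf\<close> gives intersections
  and \<open>sup\<close> gives unions.\<close>

lemma openin_hit_topology_mem_closed_set_filter:
  fixes t :: "'a::{distrib_lattice, bounded_lattice} diamond_lattice"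
  shows "openin (hit_topology spectral_plus_topology)
     {C \<in> closed_sets spectral_plus_topology. t \<in> closed_set_filter C}"
proof (induction t rule: diamond_lattice_induct)
  case (1 a)
  have "{C \<in> closed_sets spectral_plus_topology. diamond a \<in> closed_set_filter C} =
      hit_set spectral_plus_topology (plus_set a)"
    by (auto simp: hit_set_def diamond_mem_closed_set_filter)
  then show ?case
    unfolding hit_topology_def generated_topology_on_def
    by (auto intro!: topology_generated_by_Basis openin_spectral_plus_plus_set)
next
  case 2
  have "{C \<in> closed_sets spectral_plus_topology. (bot :: 'a diamond_lattice) \<in> closed_set_filter C} = {}"
    using closed_set_filter(1) prime_filter_simps(2) by blast
  then show ?case
    by (simp only: openin_empty)
next
  case 3
  have "{C \<in> closed_sets spectral_plus_topology. (top :: 'a diamond_lattice) \<in> closed_set_filter C} =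
      topspace (hit_topology spectral_plus_topology)"
    using closed_set_filter(1) prime_filter_simps(1) by (auto simp: topspace_hit_topology)
  then show ?case
    by (simp only: openin_topspace)
next
  case (4 s t)
  have "{C \<in> closed_sets spectral_plus_topology. inf s t \<in> closed_set_filter C} =
      {C \<in> closed_sets spectral_plus_topology. s \<in> closed_set_filter C} \<inter>
      {C \<in> closed_sets spectral_plus_topology. t \<in> closed_set_filter C}"
    by (auto simp: closed_set_filter(1) prime_filter_simps)
  with openin_Int[OF 4] show ?case
    by (simp only:)
next
  case (5 s t)
  have "{C \<in> closed_sets spectral_plus_topology. sup s t \<in> closed_set_filter C} =
      {C \<in> closed_sets spectral_plus_topology. s \<in> closed_set_filter C} \<union>
      {C \<in> closed_sets spectral_plus_topology. t \<in> closed_set_filter C}"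
    by (auto simp: closed_set_filter(1) prime_filter_simps)
  with openin_Un[OF 5] show ?case
    by (simp only:)
qed

text \<open>Complementary induction for \<open>minus_set t\<close>: \<open>inf\<close> gives unions
  and \<open>sup\<close> intersections. The generator case needs \<open>plus_set a\<close> to be
  compact, so that missing it is an open condition.\<close>

lemma openin_miss_topology_not_mem_closed_set_filter:
  fixes t :: "'a::{distrib_lattice, bounded_lattice} diamond_lattice"
  shows "openin (miss_topology spectral_plus_topology)
     {C \<in> closed_sets spectral_plus_topology. t \<notin> closed_set_filter C}"
proof (induction t rule: diamond_lattice_induct)
  case (1 a)
  have "{C \<in> closed_sets spectral_plus_topology. diamond a \<notin> closed_set_filter C} =
      miss_set spectral_plus_topology (plus_set a)"
    by (auto simp: miss_set_def diamond_mem_closed_set_filter)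
  then show ?case
    unfolding miss_topology_def generated_topology_on_def
    by (auto intro!: topology_generated_by_Basis compactin_spectral_plus_plus_set)
next
  case 2
  have "{C \<in> closed_sets spectral_plus_topology. (bot :: 'a diamond_lattice) \<notin> closed_set_filter C} =
      topspace (miss_topology spectral_plus_topology)"
    using closed_set_filter(1) prime_filter_simps(2) by (auto simp: topspace_miss_topology)
  then show ?case
    by (simp only: openin_topspace)
next
  case 3
  have "{C \<in> closed_sets spectral_plus_topology. (top :: 'a diamond_lattice) \<notin> closed_set_filter C} = {}"
    using closed_set_filter(1) prime_filter_simps(1) by blast
  then show ?case
    by (simp only: openin_empty)
next
  case (4 s t)
  have "{C \<in> closed_sets spectral_plus_topology. inf s t \<notin> closed_set_filter C} =
      {C \<in> closed_sets spectral_plus_topology. s \<notin> closed_set_filter C} \<union>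
      {C \<in> closed_sets spectral_plus_topology. t \<notin> closed_set_filter C}"
    by (auto simp: closed_set_filter(1) prime_filter_simps)
  with openin_Un[OF 4] show ?case
    by (simp only:)
next
  case (5 s t)
  have "{C \<in> closed_sets spectral_plus_topology. sup s t \<notin> closed_set_filter C} =
      {C \<in> closed_sets spectral_plus_topology. s \<notin> closed_set_filter C} \<inter>
      {C \<in> closed_sets spectral_plus_topology. t \<notin> closed_set_filter C}"
    by (auto simp: closed_set_filter(1) prime_filter_simps)
  with openin_Int[OF 5] show ?case
    by (simp only:)
qed

lemma continuous_map_spectral_plus_closed_set_filter:
  "continuous_map (hit_topology spectral_plus_topology) spectral_plus_topology closed_set_filter"
  unfolding continuous_map_alt
proof (intro conjI ballI allI impI)
  let ?T = "hit_topology spectral_plus_topology"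
  fix U :: "'a diamond_lattice set set"
  assume U: "openin spectral_plus_topology U"
  have "closed_set_filter -` plus_set t \<inter> topspace ?T =
      {C \<in> closed_sets spectral_plus_topology. t \<in> closed_set_filter C}" for t :: "'a diamond_lattice"
    using closed_set_filter(1) by (auto simp: topspace_hit_topology plus_set_def)
  then have "openin ?T (closed_set_filter -` plus_set t \<inter> topspace ?T)" for t :: "'a diamond_lattice"
    using openin_hit_topology_mem_closed_set_filter[of t] by (simp only:)
  then have "openin ?T (closed_set_filter -` \<Union>{plus_set t |t. plus_set t \<subseteq> U} \<inter> topspace ?T)"
    by (intro openin_vimage_Union) blast
  then show "openin ?T (closed_set_filter -` U \<inter> topspace ?T)"
    by (simp only: openin_spectral_plus_eq_Union[OF U, symmetric])
qed (use closed_set_filter(1) in \<open>auto simp: topspace_hit_topology topspace_spectral_plus\<close>)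

lemma continuous_map_spectral_minus_closed_set_filter:
  "continuous_map (miss_topology spectral_plus_topology) spectral_minus_topology closed_set_filter"
  unfolding continuous_map_alt
proof (intro conjI ballI allI impI)
  let ?T = "miss_topology spectral_plus_topology"
  fix U :: "'a diamond_lattice set set"
  assume U: "openin spectral_minus_topology U"
  have "closed_set_filter -` minus_set t \<inter> topspace ?T =
      {C \<in> closed_sets spectral_plus_topology. t \<notin> closed_set_filter C}" for t :: "'a diamond_lattice"
    using closed_set_filter(1) by (auto simp: topspace_miss_topology minus_set_def)
  then have "openin ?T (closed_set_filter -` minus_set t \<inter> topspace ?T)" for t :: "'a diamond_lattice"
    using openin_miss_topology_not_mem_closed_set_filter[of t] by (simp only:)
  then have "openin ?T (closed_set_filter -` \<Union>{minus_set t |t. minus_set t \<subseteq> U} \<inter> topspace ?T)"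
    by (intro openin_vimage_Union) blast
  then show "openin ?T (closed_set_filter -` U \<inter> topspace ?T)"
    by (simp only: openin_spectral_minus_eq_Union[OF U, symmetric])
qed (use closed_set_filter(1) in \<open>auto simp: topspace_miss_topology topspace_spectral_minus\<close>)

text \<open>The preimages of the subbasic sets split: those of \<open>plus_set t\<close> are open in
  the hit topology, those of \<open>minus_set t\<close> in the miss topology, and the join contains
  both.\<close>

lemma continuous_map_priestley_closed_set_filter:
  "continuous_map (hit_miss_topology spectral_plus_topology) priestley_topology closed_set_filter"
proof -
  let ?T = "hit_miss_topology spectral_plus_topology"
  have *: "closed_set_filter -` plus_set t \<inter> topspace ?T =
      {C \<in> closed_sets spectral_plus_topology. t \<in> closed_set_filter C}"
    "closed_set_filter -` minus_set t \<inter> topspace ?T =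
      {C \<in> closed_sets spectral_plus_topology. t \<notin> closed_set_filter C}" for t
    using closed_set_filter(1) by (auto simp: topspace_hit_miss_topology plus_set_def minus_set_def)
  have **: "closed_set_filter -` Collect prime_filter \<inter> topspace ?T = topspace ?T"
    using closed_set_filter(1) by (auto simp: topspace_hit_miss_topology)
  have ***: "openin ?T (closed_set_filter -` plus_set t \<inter> topspace ?T)"
    "openin ?T (closed_set_filter -` minus_set t \<inter> topspace ?T)" for t
    unfolding * unfolding hit_miss_topology_def
    by (rule openin_join_topology,
        simp add: openin_hit_topology_mem_closed_set_filter
          openin_miss_topology_not_mem_closed_set_filter)+
  show ?thesis
    unfolding priestley_topology_def generated_topology_on_def
  proof (rule continuous_on_generated_topo)
    fix U :: "'a diamond_lattice set set"
    assume "U \<in> insert (Collect prime_filter) (range plus_set \<union> range minus_set)"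
    then show "openin ?T (closed_set_filter -` U \<inter> topspace ?T)"
      using *** by (auto simp only: ** openin_topspace)
  qed (use ** in blast)
qed

section \<open>The three homeomorphisms\<close>

lemma homeomorphic_maps_diamond_closed_set:
  assumes "continuous_map X Y diamond_closed_set" "continuous_map Y X closed_set_filter"
    and "topspace X = Collect prime_filter" "topspace Y = closed_sets spectral_plus_topology"
  shows "homeomorphic_maps X Y diamond_closed_set closed_set_filter"
  using assms by (simp add: homeomorphic_maps_def closed_set_filter closed_set_filter_diamond_closed_set)

theorem corollary3p15:
  shows
    "order_homeomorphic_space
       (priestley_topology :: 'a::{distrib_lattice, bounded_lattice} diamond_lattice set topology) (\<subseteq>)
       (hit_miss_topology (spectral_plus_topology :: 'a set topology)) (\<subseteq>)
     \<and>
     (spectral_plus_topology :: 'a diamond_lattice set topology)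
       homeomorphic_space (hit_topology (spectral_plus_topology :: 'a set topology))
     \<and>
     (spectral_minus_topology :: 'a diamond_lattice set topology)
       homeomorphic_space (miss_topology (spectral_plus_topology :: 'a set topology))"
proof (intro conjI)
  \<comment> \<open>The same mutually inverse maps \<open>diamond_closed_set\<close> and
    \<open>closed_set_filter\<close> serve all three claims; only the topologies change.\<close>
  have "homeomorphic_maps priestley_topology
      (hit_miss_topology (spectral_plus_topology :: 'a set topology))
      diamond_closed_set closed_set_filter"
  proof (rule homeomorphic_maps_diamond_closed_set)
    show "continuous_map priestley_topology
        (hit_miss_topology (spectral_plus_topology :: 'a set topology)) diamond_closed_set"
      unfolding hit_miss_topology_def
      by (intro continuous_map_into_join_topology continuous_map_into_hit_topology
          continuous_map_into_miss_topology topspace_priestley_topology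
          openin_priestley_plus_set openin_priestley_minus_set)
  qed (simp_all add: continuous_map_priestley_closed_set_filter topspace_priestley_topology
      topspace_hit_miss_topology)
  \<comment> \<open>Inclusion is preserved and reflected by
    \<open>diamond_closed_set_subset_iff\<close>.\<close>
  then show "order_homeomorphic_space
      (priestley_topology :: 'a diamond_lattice set topology) (\<subseteq>)
      (hit_miss_topology (spectral_plus_topology :: 'a set topology)) (\<subseteq>)"
    unfolding order_homeomorphic_space_def order_homeomorphic_map_def
    by (intro exI[of _ diamond_closed_set])
      (auto simp: homeomorphic_map_maps topspace_priestley_topology
        dest: diamond_closed_set_subset_iff)
  have "homeomorphic_maps spectral_plus_topology
      (hit_topology (spectral_plus_topology :: 'a set topology))
      diamond_closed_set closed_set_filter"
    by (intro homeomorphic_maps_diamond_closed_set continuous_map_into_hit_topology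
        continuous_map_spectral_plus_closed_set_filter topspace_spectral_plus
        topspace_hit_topology openin_spectral_plus_plus_set)
  then show "(spectral_plus_topology :: 'a diamond_lattice set topology)
      homeomorphic_space (hit_topology (spectral_plus_topology :: 'a set topology))"
    unfolding homeomorphic_space_def by blast
  have "homeomorphic_maps spectral_minus_topology
      (miss_topology (spectral_plus_topology :: 'a set topology))
      diamond_closed_set closed_set_filter"
    by (intro homeomorphic_maps_diamond_closed_set continuous_map_into_miss_topology
        continuous_map_spectral_minus_closed_set_filter topspace_spectral_minus
        topspace_miss_topology openin_spectral_minus_minus_set)
  then show "(spectral_minus_topology :: 'a diamond_lattice set topology)
      homeomorphic_space (miss_topology (spectral_plus_topology :: 'a set topology))"
    unfolding homeomorphic_space_def by blast
qed

end
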